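(* Let $m\geq 2$ be an integer, let $n_1=m(m+1)$, $n_2=m(m+1)+1$, $n_3=(m+1)^2$, $n_4=(m+1)^2+1$, and let $\mathfrak{S}_m=\langle n_1,n_2,n_3,n_4\rangle$. The Apéry table $\mathrm{AT}(\mathfrak{S}_m,n_1)$ is a matrix of order $(m+1)\times n_1$ and (with the columns arranged in the order below) is the block matrix $$\mathrm{AT}(\mathfrak{S}_m,n_1)=\begin{bmatrix}\mathcal{A}_0&\mathcal{A}_1&\mathcal{A}_2&\mathcal{A}_3&\mathcal{A}_4&\mathcal{A}_5\end{bmatrix},$$ where (rows numbered $1,\dots,m+1$): (a) $\mathcal{A}_0=(a^{(0)}_{i1})$ is $(m+1)\times 1$ with $a^{(0)}_{i1}=(i-1)n_1$ for $1\leq i\leq m+1$. (b) $\mathcal{A}_1=(a^{(1)}_{ij})$ is $(m+1)\times m$ with, for $1\leq j\leq m$, $a^{(1)}_{ij}=jn_2$ if $1\leq i\leq j+1$ and $a^{(1)}_{ij}=jn_2+(i-j-1)n_1$ if $j+1<i\leq m+1$. (c) For $l=2,3$, $\mathcal{A}_l=(a^{(l)}_{ij})$ is $(m+1)\times(m-1)$ with, for $1\leq j\leq m-1$, $a^{(l)}_{ij}=jn_{l+1}$ if $1\leq i\leq j+1$ and $a^{(l)}_{ij}=jn_{l+1}+(i-j-1)n_1$ if $j+1<i\leq m+1$. (d) $\mathcal{A}_4=\begin{bmatrix}A^{(4)}_1&\cdots&A^{(4)}_{m-1}\end{bmatrix}$ is $(m+1)\times\frac{m(m-1)}{2}$, where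 $A^{(4)}_i=(a^{(i4)}_{rs})$ is $(m+1)\times(m-i)$ with, for $1\leq s\leq m-i$, $a^{(i4)}_{rs}=in_2+sn_4$ if $1\leq r\leq i+s+1$ and $a^{(i4)}_{rs}=in_2+sn_4+(r-i-s-1)n_1$ if $i+s+1<r\leq m+1$. (e) $\mathcal{A}_5=\begin{bmatrix}A^{(5)}_1&\cdots&A^{(5)}_{m-2}\end{bmatrix}$ is $(m+1)\times\frac{(m-2)(m-1)}{2}$, where $A^{(5)}_i=(a^{(i5)}_{rs})$ is $(m+1)\times(m-1-i)$ with, for $1\leq s\leq m-1-i$, $a^{(i5)}_{rs}=in_3+sn_4$ if $1\leq r\leq i+s+1$ and $a^{(i5)}_{rs}=in_3+sn_4+(r-i-s-1)n_1$ if $i+s+1<r\leq m+1$.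
   Context: $\langle a_1,\dots,a_e\rangle$ denotes the set of all non-negative integer combinations of $a_1,\dots,a_e$. Let $\Gamma$ be a numerical semigroup with smallest nonzero element $a$ (here $a=n_1$). The Apéry set is $\mathrm{Ap}(\Gamma,a)=\{s\in\Gamma\mid s-a\notin\Gamma\}$; it has $a$ elements, enumerated as $\omega_0=0,\omega_1,\dots,\omega_{a-1}$. Put $M=\Gamma\setminus\{0\}$ and $nM=M+\cdots+M$ ($n$ copies) for $n\geq 1$ (with $0M=\Gamma$). The reduction number is $r=\min\{r\mid (r+1)M=a+rM\}$. Define $\omega_{1,0}=a$ and $\omega_{1,i}=\omega_i$ for $1\leq i\leq a-1$, and inductively $\omega_{n+1,i}=\omega_{n,i}$ if $\omega_{n,i}\in(n+1)M$, and $\omega_{n+1,i}=\omega_{n,i}+a$ otherwise. The Apéry table $\mathrm{AT}(\Gamma,a)$ is the $(r+1)\times a$ matrix with rows indexed by $0\leq s\leq r$ and columns by $0\leq t\leq a-1$, whose $(0,t)$ entry is $\omega_t$ and whose $(s,t)$ entry is $\omega_{s,t}$ for $1\leq s\leq r$; it depends on the enumeration of the Apéry set only through the order of its columns. In the claim rows are numbered from $1$, so row number $i$ there is row $s=i-1$ of this definition; the column order is the one given by the enumeration of $\mathrm{Ap}(\mathfrak{S}_m,n_1)$ appearing in the first row of the block matrix. For $m=2$ the block $\mathcal{A}_5$ is empty. *)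

theory Defs
  imports "Jordan_Normal_Form.Matrix" "HOL-Library.Set_Algebras"
begin

definition semigroup_gen :: "nat list \<Rightarrow> nat set" where
  "semigroup_gen gs = {(\<Sum>i<length gs. c i * gs ! i) | c. True}"

definition numerical_semigroup :: "nat set \<Rightarrow> bool" where
  "numerical_semigroup \<Gamma> \<longleftrightarrow>
     0 \<in> \<Gamma> \<and> (\<forall>x\<in>\<Gamma>. \<forall>y\<in>\<Gamma>. x + y \<in> \<Gamma>) \<and> finite (UNIV - \<Gamma>)"

text \<open>The guard \<open>a \<le> s\<close> makes \<open>s - a \<notin> \<Gamma>\<close> refer to the subtraction of integers.\<close>
definition Apery :: "nat set \<Rightarrow> nat \<Rightarrow> nat set" where
  "Apery \<Gamma> a = {s \<in> \<Gamma>. \<not> (a \<le> s \<and> s - a \<in> \<Gamma>)}"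

definition Apery_enum :: "nat set \<Rightarrow> nat \<Rightarrow> (nat \<Rightarrow> nat) \<Rightarrow> bool" where
  "Apery_enum \<Gamma> a \<omega> \<longleftrightarrow> \<omega> 0 = 0 \<and> bij_betw \<omega> {..<a} (Apery \<Gamma> a)"

text \<open>\<open>multM \<Gamma> n\<close> is \<open>nM = M + \<dots> + M\<close> for \<open>M = \<Gamma> - {0}\<close>, where \<open>+\<close> is the
  elementwise sum of sets and \<open>0M = \<Gamma>\<close>.\<close>
fun multM :: "nat set \<Rightarrow> nat \<Rightarrow> nat set" where
  "multM \<Gamma> 0 = \<Gamma>"
| "multM \<Gamma> (Suc 0) = \<Gamma> - {0}"
| "multM \<Gamma> (Suc (Suc n)) = multM \<Gamma> (Suc n) + (\<Gamma> - {0})"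

definition reduction_number :: "nat set \<Rightarrow> nat \<Rightarrow> nat" where
  "reduction_number \<Gamma> a = (LEAST r. multM \<Gamma> (r + 1) = {a} + multM \<Gamma> r)"

text \<open>Row \<open>0\<close> is the enumeration itself. The recursion starts from row \<open>1\<close>, which differs from
  row \<open>0\<close> in the first column only.\<close>
fun Apery_entry :: "nat set \<Rightarrow> nat \<Rightarrow> (nat \<Rightarrow> nat) \<Rightarrow> nat \<Rightarrow> nat \<Rightarrow> nat" where
  "Apery_entry \<Gamma> a \<omega> 0 t = \<omega> t"
| "Apery_entry \<Gamma> a \<omega> (Suc 0) t = (if t = 0 then a else \<omega> t)"
| "Apery_entry \<Gamma> a \<omega> (Suc (Suc n)) t =
     (if Apery_entry \<Gamma> a \<omega> (Suc n) t \<in> multM \<Gamma> (Suc (Suc n))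
      then Apery_entry \<Gamma> a \<omega> (Suc n) t
      else Apery_entry \<Gamma> a \<omega> (Suc n) t + a)"

definition Apery_table :: "nat set \<Rightarrow> nat \<Rightarrow> (nat \<Rightarrow> nat) \<Rightarrow> nat mat" where
  "Apery_table \<Gamma> a \<omega> =
     mat (reduction_number \<Gamma> a + 1) a (\<lambda>(s, t). Apery_entry \<Gamma> a \<omega> s t)"

text \<open>The matrix \<open>(f i j)\<close> with row and column indices counted from \<open>1\<close>.\<close>
definition mat1 :: "nat \<Rightarrow> nat \<Rightarrow> (nat \<Rightarrow> nat \<Rightarrow> 'a) \<Rightarrow> 'a mat" where
  "mat1 nr nc f = mat nr nc (\<lambda>(i, j). f (i + 1) (j + 1))"

text \<open>The block matrix with one row of blocks, all of them with \<open>nr\<close> rows; the list of blocks and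
  each single block may be empty.\<close>
definition block_row :: "nat \<Rightarrow> 'a mat list \<Rightarrow> 'a mat" where
  "block_row nr Bs = mat_of_cols nr (concat (map cols Bs))"

end

theory Submission
  imports Defs
begin

text \<open>With \<open>N = m (m + 1)\<close> the generators are \<open>N + x + (m + 1) y\<close> for \<open>x, y \<in> {0, 1}\<close>, so the sums of
  \<open>k\<close> generators are exactly the numbers \<open>k N + x + (m + 1) y\<close> with \<open>x, y \<le> k\<close>. Every number is
  uniquely \<open>k N + x + (m + 1) y\<close> with \<open>x \<le> m\<close> and \<open>y < m\<close>, and in this form it lies in \<open>nM\<close> if and
  only if \<open>max n (max x y) \<le> k\<close>. Hence the Apery elements are those with \<open>k = max x y\<close>, the entry
  below such an element in row \<open>s\<close> is obtained by replacing \<open>k\<close> with \<open>max s (max x y)\<close>, and the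
  reduction number is the largest value \<open>m\<close> of \<open>max x y\<close>. The blocks of the table list the pairs
  \<open>(x, y)\<close> according to whether \<open>x\<close>, \<open>y\<close>, \<open>x - y\<close> are zero, positive or negative.\<close>

section \<open>Digit representation of numbers, and the layers\<close>

definition val :: "nat \<Rightarrow> nat \<Rightarrow> nat \<Rightarrow> nat \<Rightarrow> nat" where
  "val m k x y = k * (m * (m + 1)) + x + (m + 1) * y"

text \<open>The condition is \<open>n \<le> k\<close>, not \<open>n = k\<close>, since an element of
  \<open>nM\<close> is a sum of at least \<open>n\<close> generators; \<open>n = 0\<close> gives the
  semigroup. The digits need not be canonical, that is, satisfy \<open>x \<le> m\<close> and
  \<open>y < m\<close>.\<close>

definition layer :: "nat \<Rightarrow> nat \<Rightarrow> nat set" where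
  "layer m n = {val m k x y | k x y. n \<le> k \<and> x \<le> k \<and> y \<le> k}"

lemma layerI: "n \<le> k \<Longrightarrow> x \<le> k \<Longrightarrow> y \<le> k \<Longrightarrow> val m k x y \<in> layer m n"
  unfolding layer_def by blast

lemma val_add: "val m k x y + val m k' x' y' = val m (k + k') (x + x') (y + y')"
  by (simp add: val_def algebra_simps)

lemma val_Suc: "val m (Suc k) x y = val m k x y + m * (m + 1)"
  by (simp add: val_def)

text \<open>The digits contribute at most \<open>m + (m + 1) * (m - 1) = m * (m + 1) - 1\<close>, so
  \<open>k\<close> is the quotient by \<open>m * (m + 1)\<close>.\<close>

lemma val_less:
  assumes "x \<le> m" "y < m"
  shows "val m k x y < Suc k * (m * (m + 1))"
proof -
  have "(m + 1) * (y + 1) \<le> (m + 1) * m"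
    using assms by (intro mult_left_mono) auto
  then show ?thesis
    using assms by (simp add: val_def algebra_simps)
qed

text \<open>Mixed radix: \<open>x\<close> is the remainder modulo \<open>m + 1\<close>, and
  \<open>y\<close> that of the quotient modulo \<open>m\<close>.\<close>

lemma val_eq_iff:
  assumes "x \<le> m" "y < m" "x' \<le> m" "y' < m"
  shows "val m k x y = val m k' x' y' \<longleftrightarrow> k = k' \<and> x = x' \<and> y = y'"
proof
  have eq: "val m k x y = x + (m + 1) * (y + m * k)" for k x y
    by (simp add: val_def algebra_simps)
  assume "val m k x y = val m k' x' y'"
  then have *: "x + (m + 1) * (y + m * k) = x' + (m + 1) * (y' + m * k')"
    by (simp only: eq)
  have "x = x'"
    using arg_cong[OF *, of "\<lambda>z. z mod (m + 1)"] assms by (simp del: mult_Suc)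
  with * have **: "y + m * k = y' + m * k'"
    by (simp only: add_left_cancel mult_cancel1) simp
  have "y = y'"
    using arg_cong[OF **, of "\<lambda>z. z mod m"] assms by simp
  with ** assms \<open>x = x'\<close> show "k = k' \<and> x = x' \<and> y = y'"
    by simp
qed simp

lemma val_exists:
  assumes "m > 0"
  obtains k x y where "x \<le> m" "y < m" "z = val m k x y"
proof
  let ?q = "z div (m + 1)"
  show "z mod (m + 1) \<le> m"
    using mod_less_divisor[of "m + 1" z] by linarith
  show "?q mod m < m"
    using assms by simp
  have "z = z mod (m + 1) + (m + 1) * ?q"
    by (metis mod_mult_div_eq)
  also have "?q = ?q mod m + m * (?q div m)"
    by (metis mod_mult_div_eq)
  finally show "z = val m (?q div m) (z mod (m + 1)) (?q mod m)"
    by (simp only: val_def) (simp only: algebra_simps)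
qed

text \<open>A member of the layer may come with digits outside the canonical range; this forces
  \<open>j \<ge> m\<close>, and then \<open>k \<ge> j \<ge> m\<close> already bounds
  \<open>x\<close> and \<open>y\<close>.\<close>

lemma val_in_layer_iff:
  assumes "x \<le> m" "y < m"
  shows "val m k x y \<in> layer m n \<longleftrightarrow> max n (max x y) \<le> k"
proof
  assume "val m k x y \<in> layer m n"
  then obtain j x' y' where j: "n \<le> j" "x' \<le> j" "y' \<le> j" and eq: "val m k x y = val m j x' y'"
    unfolding layer_def by blast
  have "j * (m * (m + 1)) < Suc k * (m * (m + 1))"
    using val_less[OF assms, of k] eq by (simp add: val_def)
  then have "j \<le> k"
    by (metis less_Suc_eq_le mult_less_cancel2)
  moreover have "max x y \<le> k"
  \<comment> \<open>Otherwise \<open>j \<le> k < m\<close>, so \<open>x'\<close> and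
    \<open>y'\<close>, bounded by \<open>j\<close>, are canonical and uniqueness applies.\<close>
  proof (rule ccontr)
    assume "\<not> max x y \<le> k"
    then have "j < m"
      using \<open>j \<le> k\<close> assms by auto
    then have "j = k \<and> x' = x \<and> y' = y"
      using val_eq_iff[of x' m y' x y j k] j assms eq by auto
    then show False
      using j \<open>\<not> max x y \<le> k\<close> by auto
  qed
  ultimately show "max n (max x y) \<le> k"
    using j by auto
qed (auto intro: layerI)

section \<open>The semigroup and the sets \<open>nM\<close> as layers\<close>

lemma semigroup_gen_eq_layer:
  "semigroup_gen [m * (m + 1), m * (m + 1) + 1, (m + 1)\<^sup>2, (m + 1)\<^sup>2 + 1] = layer m 0"
    (is "semigroup_gen ?gs = _")
proof -
  \<comment> \<open>The generators have \<open>(k, x, y)\<close> equal to \<open>(1, 0, 0)\<close>,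
    \<open>(1, 1, 0)\<close>, \<open>(1, 0, 1)\<close>, \<open>(1, 1, 1)\<close>, in this
    order.\<close>
  have sum: "(\<Sum>i<length ?gs. c i * ?gs ! i)
      = val m (c 0 + c 1 + c 2 + c 3) (c 1 + c 3) (c 2 + c 3)" for c :: "nat \<Rightarrow> nat"
    by (simp add: val_def eval_nat_numeral algebra_simps)
  show ?thesis
  proof (intro Set.set_eqI iffI)
    fix z assume "z \<in> semigroup_gen ?gs"
    then obtain c :: "nat \<Rightarrow> nat" where "z = (\<Sum>i<length ?gs. c i * ?gs ! i)"
      unfolding semigroup_gen_def by blast
    then show "z \<in> layer m 0"
      by (simp only: sum) (rule layerI; simp)
  next
    fix z assume "z \<in> layer m 0"
    then obtain k x y where z: "z = val m k x y" and "x \<le> k" "y \<le> k"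
      unfolding layer_def by blast
    \<comment> \<open>The number of copies of the fourth generator, the only one raising both
      digits: truncated subtraction gives the least number for which \<open>k\<close> generators
      suffice.\<close>
    define d where "d = x + y - k"
    define c where "c = (\<lambda>i::nat. [k + d - x - y, x - d, y - d, d] ! i)"
    have "c 0 + c 1 + c 2 + c 3 = k" "c 1 + c 3 = x" "c 2 + c 3 = y"
      using \<open>x \<le> k\<close> \<open>y \<le> k\<close> by (auto simp: c_def d_def eval_nat_numeral)
    then have "z = (\<Sum>i<length ?gs. c i * ?gs ! i)"
      by (simp only: sum z)
    then show "z \<in> semigroup_gen ?gs"
      unfolding semigroup_gen_def by blast
  qed
qed

lemma layer_one:
  assumes "m > 0"
  shows "layer m 1 = layer m 0 - {0}"
proof (intro Set.set_eqI iffI)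
  fix z assume "z \<in> layer m 1"
  then obtain k x y where "z = val m k x y" "1 \<le> k" "x \<le> k" "y \<le> k"
    unfolding layer_def by blast
  with assms show "z \<in> layer m 0 - {0}"
    by (auto simp: layerI) (simp add: val_def)
next
  fix z assume z: "z \<in> layer m 0 - {0}"
  then obtain k x y where *: "z = val m k x y" "x \<le> k" "y \<le> k"
    unfolding layer_def by blast
  with z have "1 \<le> k"
    by (cases k) (auto simp: val_def)
  with * show "z \<in> layer m 1"
    by (simp add: layerI)
qed

lemma layer_add: "layer m n + layer m n' \<subseteq> layer m (n + n')"
proof
  fix z assume "z \<in> layer m n + layer m n'"
  then obtain k x y k' x' y' where "z = val m k x y + val m k' x' y'"
    and "n \<le> k" "x \<le> k" "y \<le> k" "n' \<le> k'" "x' \<le> k'" "y' \<le> k'"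
    unfolding layer_def set_plus_def by blast
  then show "z \<in> layer m (n + n')"
    by (simp add: val_add layerI)
qed

lemma layer_Suc: "layer m (Suc n) = layer m n + layer m 1"
proof
  show "layer m (Suc n) \<subseteq> layer m n + layer m 1"
  proof
    fix z assume "z \<in> layer m (Suc n)"
    then obtain k x y where z: "z = val m k x y" and *: "Suc n \<le> k" "x \<le> k" "y \<le> k"
      unfolding layer_def by blast
    \<comment> \<open>One generator is split off that takes a unit from each nonzero digit, so the
      remaining digits are at most \<open>k - 1\<close>.\<close>
    have "z = val m (k - 1) (x - 1) (y - 1) + val m 1 (min x 1) (min y 1)"
      unfolding val_add z using * by (intro arg_cong3[of _ _ _ _ _ _ "val m"]) auto
    moreover have "val m (k - 1) (x - 1) (y - 1) \<in> layer m n" "val m 1 (min x 1) (min y 1) \<in> layer m 1"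
      using * by (auto intro!: layerI)
    ultimately show "z \<in> layer m n + layer m 1"
      by (simp add: set_plus_intro)
  qed
qed (use layer_add[of m n 1] in simp)

lemma multM_layer:
  assumes "m > 0"
  shows "multM (layer m 0) n = layer m n"
proof -
  have "multM (layer m 0) (Suc n) = layer m (Suc n)" for n
  proof (induction n)
    case 0
    show ?case
      using layer_one[OF assms] by simp
  next
    case (Suc n)
    show ?case
      unfolding multM.simps(3) Suc layer_one[OF assms, symmetric] layer_Suc[of m "Suc n"] ..
  qed
  then show ?thesis
    by (cases n) simp_all
qed

section \<open>Reduction number, gaps and multiplicity\<close>

lemma layer_eq_atLeast:
  assumes "m > 0" "m \<le> n"
  shows "layer m n = {n * (m * (m + 1))..}"
proof (intro Set.set_eqI iffI)
  fix z assume "z \<in> layer m n"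
  then obtain k x y where "z = val m k x y" "n \<le> k"
    unfolding layer_def by blast
  then show "z \<in> {n * (m * (m + 1))..}"
    using mult_le_mono1[of n k "m * (m + 1)"] unfolding val_def atLeast_iff by linarith
next
  fix z assume z: "z \<in> {n * (m * (m + 1))..}"
  obtain k x y where *: "x \<le> m" "y < m" "z = val m k x y"
    by (rule val_exists[OF assms(1)])
  have "n * (m * (m + 1)) < Suc k * (m * (m + 1))"
    using z val_less[OF *(1,2), of k] *(3) by simp
  then have "n \<le> k"
    by (metis less_Suc_eq_le mult_less_cancel2)
  \<comment> \<open>Canonical digits are at most \<open>m \<le> n \<le> k\<close>, so the digit
    bounds of the layer hold automatically.\<close>
  with * assms show "z \<in> layer m n"
    by (simp add: layerI)
qed

lemma reduction_number_layer:
  assumes "m > 0"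
  shows "reduction_number (layer m 0) (m * (m + 1)) = m"
  unfolding reduction_number_def multM_layer[OF assms]
proof (rule Least_equality)
  show "layer m (m + 1) = {m * (m + 1)} + layer m m"
    using assms by (auto simp: layer_eq_atLeast set_plus_def nat_le_iff_add)
next
  fix r assume eq: "layer m (r + 1) = {m * (m + 1)} + layer m r"
  show "m \<le> r"
  proof (rule ccontr)
    assume "\<not> m \<le> r"
    \<comment> \<open>The test element is \<open>r + 1\<close> copies of the second generator:
      removing \<open>m * (m + 1)\<close> leaves the digit \<open>r + 1\<close> above the
      coefficient \<open>r\<close>.\<close>
    have "val m (r + 1) (r + 1) 0 \<in> layer m (r + 1)"
      by (simp add: layerI)
    then obtain w where "w \<in> layer m r" "val m (r + 1) (r + 1) 0 = m * (m + 1) + w"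
      unfolding eq set_plus_def by blast
    then have "val m r (r + 1) 0 \<in> layer m r"
      using val_Suc[of m r "r + 1" 0] by simp
    with \<open>\<not> m \<le> r\<close> show False
      by (subst (asm) val_in_layer_iff) auto
  qed
qed

text \<open>The gaps are bounded because the final segment \<open>layer m m\<close> lies in
  \<open>layer m 0\<close>.\<close>

lemma numerical_semigroup_layer:
  assumes "m > 0"
  shows "numerical_semigroup (layer m 0)"
proof -
  have "val m 0 0 0 \<in> layer m 0"
    by (simp add: layerI)
  then have "0 \<in> layer m 0"
    by (simp add: val_def)
  moreover have "x + y \<in> layer m 0" if "x \<in> layer m 0" "y \<in> layer m 0" for x y
    using set_plus_intro[OF that] layer_add[of m 0 0] by auto
  moreover have "UNIV - layer m 0 \<subseteq> {..<m * (m * (m + 1))}"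
  proof
    have "layer m m \<subseteq> layer m 0"
      unfolding layer_def by auto
    moreover fix z assume "z \<in> UNIV - layer m 0"
    ultimately have "z \<notin> layer m m"
      by blast
    then show "z \<in> {..<m * (m * (m + 1))}"
      unfolding layer_eq_atLeast[OF assms order.refl] by simp
  qed
  ultimately show ?thesis
    unfolding numerical_semigroup_def using finite_subset by blast
qed

lemma Least_layer:
  assumes "m > 0"
  shows "(LEAST s. s \<in> layer m 0 \<and> s \<noteq> 0) = m * (m + 1)"
proof (rule Least_equality)
  have "val m 1 0 0 \<in> layer m 0"
    by (simp add: layerI)
  with assms show "m * (m + 1) \<in> layer m 0 \<and> m * (m + 1) \<noteq> 0"
    by (simp add: val_def)
next
  fix s assume "s \<in> layer m 0 \<and> s \<noteq> 0"
  then have "s \<in> layer m 1"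
    using layer_one[OF assms] by simp
  then obtain k x y where "s = val m k x y" "1 \<le> k"
    unfolding layer_def by blast
  then show "m * (m + 1) \<le> s"
    using mult_le_mono1[of 1 k "m * (m + 1)"] unfolding val_def by linarith
qed

section \<open>The Apery set and the entries of the table\<close>

lemma Apery_layer:
  assumes "m > 0"
  shows "Apery (layer m 0) (m * (m + 1)) = (\<lambda>(x, y). val m (max x y) x y) ` ({..m} \<times> {..<m})"
proof -
  have iff: "val m k x y \<in> Apery (layer m 0) (m * (m + 1)) \<longleftrightarrow> k = max x y"
    if "x \<le> m" "y < m" for k x y
  proof (cases k)
    case 0
    \<comment> \<open>The guard in \<open>Apery\<close> fails for such small values, so only
      membership in the semigroup remains.\<close>
    have "val m 0 x y < m * (m + 1)"
      using val_less[OF that, of 0] by simp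
    then show ?thesis
      using 0 val_in_layer_iff[OF that] unfolding Apery_def by simp
  next
    case (Suc j)
    then have "val m k x y \<in> Apery (layer m 0) (m * (m + 1)) \<longleftrightarrow>
        val m k x y \<in> layer m 0 \<and> val m j x y \<notin> layer m 0"
      by (simp add: Apery_def val_Suc)
    then show ?thesis
      unfolding val_in_layer_iff[OF that] using Suc by auto
  qed
  show ?thesis
  proof (intro Set.set_eqI iffI)
    fix z assume z: "z \<in> Apery (layer m 0) (m * (m + 1))"
    obtain k x y where "x \<le> m" "y < m" "z = val m k x y"
      by (rule val_exists[OF assms])
    with z iff show "z \<in> (\<lambda>(x, y). val m (max x y) x y) ` ({..m} \<times> {..<m})"
      by force
  qed (use iff in auto)
qed

text \<open>Passing to the next row raises the leading coefficient by one exactly when it falls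
  short of the new row number. The last hypothesis ties the specially treated column
  \<open>0\<close> to the digits \<open>(0, 0)\<close>.\<close>

lemma Apery_entry_layer:
  assumes "x \<le> m" "y < m"
    and "\<omega> t = val m (max x y) x y" and "t = 0 \<longleftrightarrow> x = 0 \<and> y = 0"
  shows "Apery_entry (layer m 0) (m * (m + 1)) \<omega> s t = val m (max s (max x y)) x y"
proof -
  have "m > 0"
    using assms by simp
  have "Apery_entry (layer m 0) (m * (m + 1)) \<omega> (Suc s) t = val m (max (Suc s) (max x y)) x y" for s
  proof (induction s)
    case 0
    show ?case
    \<comment> \<open>Column \<open>0\<close> becomes \<open>val m 1 0 0\<close> in row one; every
      other column has a nonzero digit, so \<open>max x y\<close> is at least one.\<close>
    proof (cases "t = 0")
      case True
      with assms show ?thesis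
        by (simp add: val_def)
    next
      case False
      with assms(4) have "max (Suc 0) (max x y) = max x y"
        by auto
      with False assms(3) show ?thesis
        by simp
    qed
  next
    case (Suc s)
    let ?K = "max (Suc s) (max x y)"
    have "val m ?K x y \<in> layer m (Suc (Suc s)) \<longleftrightarrow> Suc (Suc s) \<le> max x y"
      by (subst val_in_layer_iff[OF assms(1,2)]) auto
    moreover have "max (Suc (Suc s)) (max x y) =
        (if Suc (Suc s) \<le> max x y then ?K else Suc ?K)"
      by auto
    ultimately show ?case
      using Suc by (simp add: multM_layer[OF \<open>m > 0\<close>] val_Suc del: multM.simps)
  qed
  then show ?thesis
    using assms(3) by (cases s) simp_all
qed

section \<open>The digit pairs in the order of the columns\<close>

definition triangle :: "nat \<Rightarrow> (nat \<Rightarrow> nat \<Rightarrow> 'a) \<Rightarrow> 'a list" where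
  "triangle n f = concat (map (\<lambda>i. map (f i) [1..<n - i + 1]) [1..<n])"

lemma set_triangle: "set (triangle n f) = {f i s | i s. 1 \<le> i \<and> 1 \<le> s \<and> i + s \<le> n}"
  unfolding triangle_def by force

lemma length_triangle: "length (triangle n f) = n * (n - 1) div 2"
proof -
  have "length (triangle n f) = (\<Sum>i = 1..<n. n - i)"
    unfolding triangle_def
    by (simp add: length_concat comp_def interv_sum_list_conv_sum_set_nat del: upt_Suc)
  also have "\<dots> = (\<Sum>i = 1..<n. i)"
    by (rule sum.reindex_bij_witness[of _ "\<lambda>i. n - i" "\<lambda>i. n - i"]) auto
  also have "\<dots> = n * (n - 1) div 2"
    by (simp add: Sum_Ico_nat)
  finally show ?thesis .
qed

lemma map_triangle: "map g (triangle n f) = triangle n (\<lambda>i s. g (f i s))"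
  by (simp add: triangle_def map_concat comp_def)

text \<open>The six lists follow the blocks \<open>A0\<close> to \<open>A5\<close>: the digits of
  zero, \<open>j * n2\<close>, \<open>j * n3\<close>, \<open>j * n4\<close>,
  \<open>i * n2 + s * n4\<close> and \<open>i * n3 + s * n4\<close>.\<close>

definition digit_pairs :: "nat \<Rightarrow> (nat \<times> nat) list" where
  "digit_pairs m = [(0, 0)] @ map (\<lambda>j. (j, 0)) [1..<m + 1] @ map (\<lambda>j. (0, j)) [1..<m]
     @ map (\<lambda>j. (j, j)) [1..<m] @ triangle m (\<lambda>i s. (i + s, s))
     @ triangle (m - 1) (\<lambda>i s. (s, i + s))"

lemma length_digit_pairs:
  assumes "m \<ge> 2"
  shows "length (digit_pairs m) = m * (m + 1)"
proof -
  obtain k where k: "m = k + 2"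
    using assms by (metis le_add_diff_inverse2)
  \<comment> \<open>Makes both divisions by two in the triangle lengths exact.\<close>
  have "even ((k + 1) * k)"
    by simp
  then obtain j where j: "(k + 1) * k = 2 * j"
    by (elim evenE)
  then have j': "(k + 2) * (k + 1) = 2 * (j + k + 1)"
    by (simp add: algebra_simps)
  have "length (digit_pairs m)
      = 1 + m + (m - 1) + (m - 1) + m * (m - 1) div 2 + (m - 1) * (m - 1 - 1) div 2"
    by (simp add: digit_pairs_def length_triangle del: upt_Suc)
  also have "\<dots> = 1 + (k + 2) + (k + 1) + (k + 1) + (k + 2) * (k + 1) div 2 + (k + 1) * k div 2"
    by (simp add: k)
  also have "\<dots> = 4 * k + 2 * j + 6"
    unfolding j j' by simp
  also have "\<dots> = m * (m + 1)"
    using j by (simp add: k algebra_simps)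
  finally show ?thesis .
qed

lemma set_digit_pairs: "m > 0 \<Longrightarrow> set (digit_pairs m) = {..m} \<times> {..<m}"
proof (intro Set.set_eqI iffI)
  fix p assume "m > 0" "p \<in> {..m} \<times> {..<m}"
  then obtain x y where p: "p = (x, y)" "x \<le> m" "y < m"
    by auto
  consider "y = 0" | "x = 0" "y > 0" | "x = y" "y > 0" | "x > y" "y > 0" | "x > 0" "y > x"
    by linarith
  then show "p \<in> set (digit_pairs m)"
  proof cases
    \<comment> \<open>The triangle indices are the difference of the digits and the smaller digit;
      likewise in the next case.\<close>
    case 4
    then have "p = (x - y + y, y)" "1 \<le> x - y" "1 \<le> y" "x - y + y \<le> m"
      using p by auto
    then show ?thesis
      unfolding digit_pairs_def set_append set_triangle by blast
  next
    case 5
    then have "p = (x, y - x + x)" "1 \<le> y - x" "1 \<le> x" "y - x + x \<le> m - 1"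
      using p by auto
    then show ?thesis
      unfolding digit_pairs_def set_append set_triangle by blast
  qed (use p in \<open>auto simp: digit_pairs_def\<close>)
qed (auto simp: digit_pairs_def set_triangle)

text \<open>Counting replaces pairwise disjointness: a list of length \<open>m * (m + 1)\<close>
  covering a set of that size cannot repeat.\<close>

lemma distinct_digit_pairs: "m \<ge> 2 \<Longrightarrow> distinct (digit_pairs m)"
  by (rule card_distinct) (simp add: set_digit_pairs length_digit_pairs)

section \<open>Columns of the block matrix\<close>

lemma cols_mat1: "cols (mat1 nr nc f) = map (\<lambda>j. vec nr (\<lambda>i. f (i + 1) j)) [1..<nc + 1]"
  by (rule nth_equalityI) (auto simp: mat1_def simp del: upt_Suc)

lemma cols_block_row:
  assumes "\<And>A. A \<in> set Bs \<Longrightarrow> dim_row A = nr"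
  shows "cols (block_row nr Bs) = concat (map cols Bs)"
  unfolding block_row_def using assms
  by (intro cols_mat_of_cols) (auto simp: cols_def intro!: carrier_vecI)

text \<open>The column that \<open>Apery_entry_layer\<close> predicts for the digits
  \<open>(x, y)\<close>.\<close>

definition table_col :: "nat \<Rightarrow> nat \<times> nat \<Rightarrow> nat vec" where
  "table_col m = (\<lambda>(x, y). vec (m + 1) (\<lambda>s. val m (max s (max x y)) x y))"

text \<open>Turns the maximum into the case distinction of the blocks: row \<open>i\<close> there is
  \<open>s = i - 1\<close>, so \<open>s \<le> k\<close> reads \<open>i \<le> k + 1\<close>.\<close>

lemma val_max:
  "val m (max s k) x y = (if s \<le> k then val m k x y else val m k x y + (s - k) * (m * (m + 1)))"
proof (cases "s \<le> k")
  case False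
  then obtain d where "s = k + d"
    using le_Suc_ex nat_le_linear by blast
  then show ?thesis
    by (simp add: val_def add_mult_distrib)
qed simp

section \<open>Comparison of the block matrix with the Apery table\<close>

theorem theorem4p4:
  fixes m n1 n2 n3 n4 :: nat
    and S :: "nat set"
    and A0 A1 A2 A3 A4 A5 B :: "nat mat"
    and A4' A5' :: "nat \<Rightarrow> nat mat"
    and \<omega> :: "nat \<Rightarrow> nat"
  assumes m: "m \<ge> 2"
    and n1: "n1 = m * (m + 1)"
    and n2: "n2 = m * (m + 1) + 1"
    and n3: "n3 = (m + 1)^2"
    and n4: "n4 = (m + 1)^2 + 1"
    and S: "S = semigroup_gen [n1, n2, n3, n4]"
    and A0: "A0 = mat1 (m + 1) 1 (\<lambda>i j. (i - 1) * n1)"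
    and A1: "A1 = mat1 (m + 1) m (\<lambda>i j.
               if i \<le> j + 1 then j * n2 else j * n2 + (i - j - 1) * n1)"
    and A2: "A2 = mat1 (m + 1) (m - 1) (\<lambda>i j.
               if i \<le> j + 1 then j * n3 else j * n3 + (i - j - 1) * n1)"
    and A3: "A3 = mat1 (m + 1) (m - 1) (\<lambda>i j.
               if i \<le> j + 1 then j * n4 else j * n4 + (i - j - 1) * n1)"
    and A4': "\<And>i. A4' i = mat1 (m + 1) (m - i) (\<lambda>r s.
               if r \<le> i + s + 1 then i * n2 + s * n4
               else i * n2 + s * n4 + (r - i - s - 1) * n1)"
    and A4: "A4 = block_row (m + 1) (map A4' [1..<m])"
    and A5': "\<And>i. A5' i = mat1 (m + 1) (m - 1 - i) (\<lambda>r s.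
               if r \<le> i + s + 1 then i * n3 + s * n4
               else i * n3 + s * n4 + (r - i - s - 1) * n1)"
    and A5: "A5 = block_row (m + 1) (map A5' [1..<m - 1])"
    and B: "B = block_row (m + 1) [A0, A1, A2, A3, A4, A5]"
    and \<omega>: "\<omega> = (\<lambda>t. B $$ (0, t))"
  shows "numerical_semigroup S \<and> n1 = (LEAST s. s \<in> S \<and> s \<noteq> 0) \<and>
         Apery_enum S n1 \<omega> \<and>
         A4 \<in> carrier_mat (m + 1) (m * (m - 1) div 2) \<and>
         A5 \<in> carrier_mat (m + 1) ((m - 2) * (m - 1) div 2) \<and>
         Apery_table S n1 \<omega> \<in> carrier_mat (m + 1) n1 \<and>
         Apery_table S n1 \<omega> = B"
proof -
  have "m > 0"
    using m by simp
  have S': "S = layer m 0"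
    unfolding S n1 n2 n3 n4 by (rule semigroup_gen_eq_layer)
  \<comment> \<open>In each equation the leading coefficient is the larger digit, as in the top row
    of \<open>table_col\<close>.\<close>
  have v: "val m j j 0 = j * n2" "val m j 0 j = j * n3" "val m j j j = j * n4"
    "val m (i + j) (i + j) j = i * n2 + j * n4" "val m (i + j) j (i + j) = i * n3 + j * n4" for i j
    unfolding val_def n2 n3 n4 by (simp_all add: power2_eq_square algebra_simps)
  have m1: "m - 1 + 1 = m"
    using m by simp
  have c0: "cols A0 = [table_col m (0, 0)]"
    unfolding A0 cols_mat1 by (simp add: n1 table_col_def val_def)
  have c1: "cols A1 = map (\<lambda>j. table_col m (j, 0)) [1..<m + 1]"
    unfolding A1 cols_mat1 table_col_def by (auto simp: val_max v n1 intro!: eq_vecI simp del: upt_Suc)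
  have c2: "cols A2 = map (\<lambda>j. table_col m (0, j)) [1..<m]"
    unfolding A2 cols_mat1 table_col_def m1 by (auto simp: val_max v n1 intro!: eq_vecI)
  have c3: "cols A3 = map (\<lambda>j. table_col m (j, j)) [1..<m]"
    unfolding A3 cols_mat1 table_col_def m1 by (auto simp: val_max v n1 intro!: eq_vecI)
  have "cols (A4' i) = map (\<lambda>s. table_col m (i + s, s)) [1..<m - i + 1]" for i
    unfolding A4' cols_mat1 table_col_def
    by (auto simp: val_max v n1 max_absorb1 intro!: eq_vecI simp del: upt_Suc)
  then have c4: "cols A4 = triangle m (\<lambda>i s. table_col m (i + s, s))"
    unfolding A4 by (subst cols_block_row) (auto simp: A4' mat1_def triangle_def comp_def)
  have "cols (A5' i) = map (\<lambda>s. table_col m (s, i + s)) [1..<m - 1 - i + 1]" for i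
    unfolding A5' cols_mat1 table_col_def
    by (auto simp: val_max v n1 max_absorb2 intro!: eq_vecI simp del: upt_Suc)
  then have c5: "cols A5 = triangle (m - 1) (\<lambda>i s. table_col m (s, i + s))"
    unfolding A5 by (subst cols_block_row) (auto simp: A5' mat1_def triangle_def comp_def)
  let ?P = "digit_pairs m"
  have B': "B = mat_of_cols (m + 1) (map (table_col m) ?P)"
    unfolding B block_row_def by (simp add: c0 c1 c2 c3 c4 c5 digit_pairs_def map_triangle comp_def del: upt_Suc)
  have len: "length ?P = n1"
    using length_digit_pairs[OF m] n1 by simp
  have Bc: "B \<in> carrier_mat (m + 1) n1"
    unfolding B' by (simp add: len carrier_matI)
  have entry: "B $$ (s, t) = val m (max s (max x y)) x y"
    if "s < m + 1" "t < n1" "?P ! t = (x, y)" for s t x y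
    unfolding B' using that len by (simp add: mat_of_cols_index table_col_def)
  have pair: "x \<le> m" "y < m" "t = 0 \<longleftrightarrow> x = 0 \<and> y = 0" if "t < n1" "?P ! t = (x, y)" for t x y
  proof -
    have "(x, y) \<in> set ?P"
      using that len by (metis nth_mem)
    then show "x \<le> m" "y < m"
      using set_digit_pairs[OF \<open>m > 0\<close>] by auto
    have "?P ! 0 = (0, 0)"
      by (simp add: digit_pairs_def)
    \<comment> \<open>Distinctness keeps \<open>(0, 0)\<close> out of all positions but the
      first.\<close>
    then have "t = 0 \<longleftrightarrow> ?P ! t = (0, 0)"
      using nth_eq_iff_index_eq[OF distinct_digit_pairs[OF m], of t 0] that len by auto
    then show "t = 0 \<longleftrightarrow> x = 0 \<and> y = 0"
      using that by simp
  qed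
  let ?w = "\<lambda>(x, y). val m (max x y) x y"
  have \<omega>': "\<omega> t = ?w (?P ! t)" if "t < n1" for t
    unfolding \<omega> using entry[of 0 t] that by (cases "?P ! t") simp
  have enum: "Apery_enum S n1 \<omega>"
    unfolding Apery_enum_def
  proof
    show "\<omega> 0 = 0"
      using \<omega>'[of 0] n1 m by (simp add: digit_pairs_def val_def)
    \<comment> \<open>The top row is the composite of two bijections, from positions to digit pairs
      and from these to Apery elements.\<close>
    have "inj_on ?w ({..m} \<times> {..<m})"
      by (auto intro!: inj_onI simp: val_eq_iff)
    then have "bij_betw ?w (set ?P) (Apery S n1)"
      unfolding S' n1 Apery_layer[OF \<open>m > 0\<close>] set_digit_pairs[OF \<open>m > 0\<close>]
      by (rule inj_on_imp_bij_betw)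
    moreover have "bij_betw (nth ?P) {..<n1} (set ?P)"
      using bij_betw_nth[OF distinct_digit_pairs[OF m]] len by simp
    ultimately have "bij_betw (?w \<circ> nth ?P) {..<n1} (Apery S n1)"
      by (rule bij_betw_trans[rotated])
    then show "bij_betw \<omega> {..<n1} (Apery S n1)"
      using \<omega>' by (subst bij_betw_cong[where g = "?w \<circ> nth ?P"]) auto
  qed
  have red: "reduction_number S n1 = m"
    unfolding S' n1 by (rule reduction_number_layer[OF \<open>m > 0\<close>])
  have AT: "Apery_table S n1 \<omega> = B"
  proof (rule eq_matI)
    fix s t assume "s < dim_row B" "t < dim_col B"
    with Bc have st: "s < m + 1" "t < n1"
      by auto
    obtain x y where P: "?P ! t = (x, y)"
      by fastforce
    have "Apery_entry S n1 \<omega> s t = B $$ (s, t)"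
      unfolding S' n1 using pair[OF st(2) P] \<omega>'[OF st(2)] entry[OF st P] P
      by (subst Apery_entry_layer) auto
    then show "Apery_table S n1 \<omega> $$ (s, t) = B $$ (s, t)"
      unfolding Apery_table_def using st red by simp
  qed (use Bc red in \<open>auto simp: Apery_table_def\<close>)
  have A4c: "A4 \<in> carrier_mat (m + 1) (m * (m - 1) div 2)"
  proof
    show "dim_row A4 = m + 1"
      unfolding A4 block_row_def by simp
    \<comment> \<open>The width is the length of the column list in \<open>c4\<close>.\<close>
    show "dim_col A4 = m * (m - 1) div 2"
      using arg_cong[OF c4, of length] by (simp add: length_triangle)
  qed
  have A5c: "A5 \<in> carrier_mat (m + 1) ((m - 2) * (m - 1) div 2)"
  proof
    show "dim_row A5 = m + 1"
      unfolding A5 block_row_def by simp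
    have "m - 1 - 1 = m - 2"
      by simp
    then show "dim_col A5 = (m - 2) * (m - 1) div 2"
      using arg_cong[OF c5, of length] by (simp add: length_triangle mult.commute)
  qed
  show ?thesis
    using numerical_semigroup_layer[OF \<open>m > 0\<close>] Least_layer[OF \<open>m > 0\<close>] enum A4c A5c AT Bc S' n1
    by simp
qed

end
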